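(* Let $n,d\ge1$ be integers. If $Z\subset Q^n_1$ has $(n-1)$-Hausdorff measure $H_{n-1}(Z)$ satisfying $$H_{n-1}(Z)>2\sqrt{n^{n-1}}\,C_{n-1}(n,d),$$ then $Z$ is $d$-definite. In particular, any curve $Z\subset Q^2_1$ whose length $l(Z)$ satisfies $l(Z)>16\sqrt2\,d$ is $d$-definite.
   Context: $Q^n_1=[0,1]^n\subset\mathbb{R}^n$ is the unit cube. A set $Z\subset Q^n_1$ is called $d$-definite if there is a constant $C(d,Z)$ such that every real polynomial $P(x_1,\dots,x_n)$ of degree at most $d$ with $|P|\le 1$ on $Z$ satisfies $|P|\le C(d,Z)$ on $Q^n_1$. For $\beta\ge0$ (with $r^0=1$) the $\beta$-Hausdorff measure is $H_\beta(Z)=\lim_{\alpha\to0}H^\alpha_\beta(Z)$, where $H^\alpha_\beta(Z)$ is the infimum of the sums $\sum_{i} r_i^\beta$ over all countable covers $Z\subset\bigcup_{i}A_i$ with (Euclidean) $\mathrm{diam}\,A_i\le r_i\le\alpha$. The length $l(Z)$ of a curve $Z$ is its one-dimensional Hausdorff measure as a set. For a bounded set $A\subset\mathbb{R}^n$ and $\varepsilon>0$, $M(\varepsilon,A)$ is the minimal number of closed axis-parallel cubes of edge length $\varepsilon$ covering $A$; $\mu_n$ is Lebesgue measure; for a real polynomial $P$ and $\rho\ge 0$, $V_\rho(P)=\{x\in Q^n_1: |P(x)|\le\rho\}$. Vitushkin's bound (a known result) states that there are positive constants $C_i(n,d)$, $0\le i\le n-1$, depending only on $n,d$, such that for every real polynomial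 $P$ in $n$ variables of degree at most $d$, every $\rho\ge0$ and every $\varepsilon>0$, $$M(\varepsilon,V_\rho(P))\le\sum_{i=0}^{n-1}C_i(n,d)\varepsilon^{-i}+\mu_n(V_\rho(P))\varepsilon^{-n}.$$ Such constants are fixed: $C_0(1,d)=d$; $C_0(2,d)=(2d-1)^2$, $C_1(2,d)=8d$; in general they have the form $C_i(n,d)=C_i'(n)(2d)^{n-i}$. *)

theory Defs
  imports "HOL-Analysis.Analysis" "HOL-Library.Poly_Mapping"
begin

section \<open>Real polynomials in n variables\<close>

text \<open>
  The variables are indexed by the finite type \<open>'n\<close>, so \<open>n = CARD('n)\<close>. A monomial is its
  exponent vector, and a polynomial is a finitely supported family of real coefficients.
\<close>

type_synonym 'n rpoly = "('n \<Rightarrow>\<^sub>0 nat) \<Rightarrow>\<^sub>0 real"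

definition peval :: "'n::finite rpoly \<Rightarrow> real^'n \<Rightarrow> real" where
  "peval P x = (\<Sum>m\<in>Poly_Mapping.keys P.
     Poly_Mapping.lookup P m * (\<Prod>i\<in>UNIV. (x $ i) ^ Poly_Mapping.lookup m i))"

definition total_degree_le :: "'n::finite rpoly \<Rightarrow> nat \<Rightarrow> bool" where
  "total_degree_le P d \<longleftrightarrow>
     (\<forall>m\<in>Poly_Mapping.keys P. (\<Sum>i\<in>UNIV. Poly_Mapping.lookup m i) \<le> d)"

definition unit_cube :: "(real^'n::finite) set" where
  "unit_cube = {x. \<forall>i. 0 \<le> x $ i \<and> x $ i \<le> 1}"

definition d_definite :: "nat \<Rightarrow> (real^'n::finite) set \<Rightarrow> bool" where
  "d_definite d Z \<longleftrightarrow> (\<exists>K::real. \<forall>P. total_degree_le P d \<longrightarrow>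
     (\<forall>x\<in>Z. \<bar>peval P x\<bar> \<le> 1) \<longrightarrow> (\<forall>x\<in>unit_cube. \<bar>peval P x\<bar> \<le> K))"


section \<open>Hausdorff measure\<close>

text \<open>Unlike \<open>powr\<close>, the convention here is \<open>0\<^sup>0 = 1\<close>.\<close>

definition hpow :: "real \<Rightarrow> real \<Rightarrow> real" where
  "hpow r \<beta> = (if \<beta> = 0 then 1 else r powr \<beta>)"

text \<open>
  Covers are indexed by an arbitrary, possibly finite, set \<open>I\<close> of naturals: padding a finite cover
  with empty sets would change the sum when \<open>\<beta> = 0\<close>. Boundedness of the pieces is required
  because \<open>diameter\<close> has a junk value on unbounded sets.
\<close>

definition hausdorff_content :: "real \<Rightarrow> real \<Rightarrow> 'a::metric_space set \<Rightarrow> ennreal" where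
  "hausdorff_content \<beta> \<alpha> Z =
     Inf {(\<Sum>\<^sub>\<infinity>i\<in>I. ennreal (hpow (r i) \<beta>)) | (I :: nat set) (A :: nat \<Rightarrow> 'a set) (r :: nat \<Rightarrow> real).
        Z \<subseteq> (\<Union>i\<in>I. A i) \<and> (\<forall>i\<in>I. bounded (A i) \<and> diameter (A i) \<le> r i \<and> r i \<le> \<alpha>)}"

definition hausdorff_measure :: "real \<Rightarrow> 'a::metric_space set \<Rightarrow> ennreal" where
  "hausdorff_measure \<beta> Z = Lim (at_right 0) (\<lambda>\<alpha>. hausdorff_content \<beta> \<alpha> Z)"

lemma hausdorff_content_antimono:
  assumes "\<alpha> \<le> \<alpha>'"
  shows "hausdorff_content \<beta> \<alpha>' Z \<le> hausdorff_content \<beta> \<alpha> Z"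
  unfolding hausdorff_content_def
  by (rule Inf_superset_mono) (use assms order_trans in blast)

lemma hausdorff_content_tendsto:
  "((\<lambda>\<alpha>. hausdorff_content \<beta> \<alpha> Z) \<longlongrightarrow> (SUP \<alpha>\<in>{0<..}. hausdorff_content \<beta> \<alpha> Z)) (at_right 0)"
proof (rule order_tendstoI)
  fix a assume "a < (SUP \<alpha>\<in>{0<..}. hausdorff_content \<beta> \<alpha> Z)"
  then obtain \<alpha> :: real where \<alpha>: "\<alpha> > 0" "a < hausdorff_content \<beta> \<alpha> Z"
    by (auto simp: less_SUP_iff)
  show "\<forall>\<^sub>F x in at_right 0. a < hausdorff_content \<beta> x Z"
    unfolding eventually_at_right_field
  proof (intro exI[of _ \<alpha>] conjI allI impI)
    fix y :: real assume "0 < y" "y < \<alpha>"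
    then show "a < hausdorff_content \<beta> y Z"
      using \<alpha>(2) hausdorff_content_antimono[of y \<alpha> \<beta> Z] by simp
  qed (use \<alpha> in simp)
next
  fix a assume a: "(SUP \<alpha>\<in>{0<..}. hausdorff_content \<beta> \<alpha> Z) < a"
  have "hausdorff_content \<beta> x Z < a" if "x > 0" for x
    using a that by (meson SUP_upper greaterThan_iff order_le_less_trans)
  then show "\<forall>\<^sub>F x in at_right 0. hausdorff_content \<beta> x Z < a"
    by (simp add: eventually_at_right_less eventually_mono[OF eventually_at_right_less])
qed

lemma hausdorff_measure_eq_SUP:
  "hausdorff_measure \<beta> Z = (SUP \<alpha>\<in>{0<..}. hausdorff_content \<beta> \<alpha> Z)"
  unfolding hausdorff_measure_def
  by (rule tendsto_Lim[OF trivial_limit_at_right_real hausdorff_content_tendsto])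

text \<open>
  A curve is the continuous image of an interval of the real line, which need not be compact;
  its length is the one-dimensional Hausdorff measure of this image.
\<close>

definition is_curve :: "'a::topological_space set \<Rightarrow> bool" where
  "is_curve Z \<longleftrightarrow> (\<exists>(T :: real set) \<gamma>. is_interval T \<and> continuous_on T \<gamma> \<and> Z = \<gamma> ` T)"

definition curve_length :: "'a::metric_space set \<Rightarrow> ennreal" where
  "curve_length Z = hausdorff_measure 1 Z"


section \<open>Covering numbers and Vitushkin's bound\<close>

definition covering_number :: "real \<Rightarrow> (real^'n::finite) set \<Rightarrow> nat" where
  "covering_number \<epsilon> A = (LEAST k. \<exists>S :: (real^'n) set. finite S \<and> card S = k \<and>
     A \<subseteq> (\<Union>a\<in>S. {x. \<forall>i. a $ i \<le> x $ i \<and> x $ i \<le> a $ i + \<epsilon>}))"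

definition sublevel_set :: "real \<Rightarrow> 'n::finite rpoly \<Rightarrow> (real^'n) set" where
  "sublevel_set \<rho> P = {x\<in>unit_cube. \<bar>peval P x\<bar> \<le> \<rho>}"

text \<open>
  \<open>C 0, \<dots>, C (n-1)\<close> are admissible constants in Vitushkin's bound for the given dimension
  \<open>n = CARD('n)\<close> and degree \<open>d\<close>.
\<close>

definition vitushkin_constants :: "'n::finite itself \<Rightarrow> nat \<Rightarrow> (nat \<Rightarrow> real) \<Rightarrow> bool" where
  "vitushkin_constants _ d C \<longleftrightarrow>
     (\<forall>i<CARD('n). C i > 0) \<and>
     (\<forall>(P :: 'n rpoly) \<rho> \<epsilon>. total_degree_le P d \<longrightarrow> \<rho> \<ge> 0 \<longrightarrow> \<epsilon> > 0 \<longrightarrow>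
        real (covering_number \<epsilon> (sublevel_set \<rho> P))
          \<le> (\<Sum>i<CARD('n). C i / \<epsilon> ^ i) + measure lebesgue (sublevel_set \<rho> P) / \<epsilon> ^ CARD('n))"

end

theory Submission
  imports Defs
begin

text \<open>
  Polynomials of degree at most \<open>d\<close> form a finite-dimensional space, so definiteness is a question
  of uniqueness only: if every such polynomial that vanishes on \<open>Z\<close> vanishes on the whole cube, then
  finitely many points of \<open>Z\<close> already interpolate all of them, and the interpolation formula gives
  the uniform bound (\<open>vanishing_polynomial_if_not_d_definite\<close>). Hence a set that is not
  \<open>d\<close>-definite lies in the zero set of a polynomial \<open>P\<close> of degree at most \<open>d\<close> that is not
  identically zero, and it remains to see that the relevant part of such a zero set has small
  Hausdorff measure.

  In dimension \<open>n\<close> the zero set is Lebesgue null (\<open>negligible_zeros\<close>), so the volume term of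
  Vitushkin's bound at level \<open>\<rho> = 0\<close> disappears. At most
  \<open>C\<^sub>0 + \<dots> + C\<^sub>n\<^sub>-\<^sub>1 \<epsilon>\<^sup>1\<^sup>-\<^sup>n\<close> cubes of diameter \<open>\<surd>n \<epsilon>\<close> cover it, and letting \<open>\<epsilon>\<close> tend to
  zero leaves at most \<open>\<surd>(n\<^sup>n\<^sup>-\<^sup>1) C\<^sub>n\<^sub>-\<^sub>1\<close> of \<open>(n-1)\<close>-dimensional measure
  (\<open>hausdorff_measure_zeros_le\<close>).

  For a plane curve in the zero set the estimate comes from connectedness. Cut the square by a grid of mesh \<open>1/N\<close>, shifted so that no grid
  line lies in the zero set; each grid line then carries at most \<open>d\<close> zeros of \<open>P\<close>, which makes
  about \<open>2Nd\<close> zeros altogether. A connected set that is not contained in one grid cell meets the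
  boundary of every cell that it enters, so each of its points is close to one of these zeros
  (\<open>cover_connected_zeros\<close>). Squares of edge \<open>2/N\<close> around the zeros therefore cover the curve,
  and its length is at most \<open>4\<surd>2 d\<close> (\<open>hausdorff_measure_connected_zeros_le\<close>).
  Either estimate contradicts the lower bound assumed for \<open>Z\<close>.
\<close>

section \<open>Zeros on lines and the measure of zero sets\<close>

lemma peval_on_line_poly:
  fixes P :: "'n::finite rpoly" and x v :: "real^'n"
  assumes "total_degree_le P d"
  obtains p :: "real poly" where "degree p \<le> d" "\<And>t. poly p t = peval P (x + t *\<^sub>R v)"
proof
  define p where "p = (\<Sum>m\<in>Poly_Mapping.keys P. smult (Poly_Mapping.lookup P m)
     (\<Prod>i\<in>UNIV. [:x $ i, v $ i:] ^ Poly_Mapping.lookup m i))"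
  show "poly p t = peval P (x + t *\<^sub>R v)" for t
    by (simp add: p_def peval_def poly_sum poly_prod)
  show "degree p \<le> d"
    unfolding p_def
  proof (rule degree_sum_le)
    fix m assume "m \<in> Poly_Mapping.keys P"
    have "degree (\<Prod>i\<in>UNIV. [:x $ i, v $ i:] ^ Poly_Mapping.lookup m i)
        \<le> (\<Sum>i\<in>UNIV. degree ([:x $ i, v $ i:] ^ Poly_Mapping.lookup m i))"
      using degree_prod_sum_le[of UNIV "\<lambda>i. [:x $ i, v $ i:] ^ Poly_Mapping.lookup m i"]
      by (simp add: o_def)
    also have "\<dots> \<le> (\<Sum>i\<in>UNIV. Poly_Mapping.lookup m i)"
    proof (rule sum_mono)
      fix i
      have "degree ([:x $ i, v $ i:] ^ Poly_Mapping.lookup m i)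
          \<le> degree [:x $ i, v $ i:] * Poly_Mapping.lookup m i"
        by (rule degree_power_le)
      also have "\<dots> \<le> 1 * Poly_Mapping.lookup m i"
        by (intro mult_right_mono) auto
      finally show "degree ([:x $ i, v $ i:] ^ Poly_Mapping.lookup m i) \<le> Poly_Mapping.lookup m i"
        by simp
    qed
    also have "\<dots> \<le> d"
      using assms \<open>m \<in> Poly_Mapping.keys P\<close> by (auto simp: total_degree_le_def)
    finally show "degree (smult (Poly_Mapping.lookup P m)
        (\<Prod>i\<in>UNIV. [:x $ i, v $ i:] ^ Poly_Mapping.lookup m i)) \<le> d"
      using degree_smult_le order_trans by blast
  qed simp
qed

lemma zeros_on_line:
  fixes P :: "'n::finite rpoly"
  assumes "total_degree_le P d" and "peval P (x + s *\<^sub>R v) \<noteq> 0"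
  shows "finite {t. peval P (x + t *\<^sub>R v) = 0}" and "card {t. peval P (x + t *\<^sub>R v) = 0} \<le> d"
proof -
  obtain p :: "real poly" where p: "degree p \<le> d" "\<And>t. poly p t = peval P (x + t *\<^sub>R v)"
    using peval_on_line_poly[OF assms(1)] by metis
  have "p \<noteq> 0"
    using assms(2) p(2)[of s] by auto
  then have "finite {t. poly p t = 0}" "card {t. poly p t = 0} \<le> degree p"
    by (auto intro: poly_roots_finite card_poly_roots_bound)
  with p show "finite {t. peval P (x + t *\<^sub>R v) = 0}" "card {t. peval P (x + t *\<^sub>R v) = 0} \<le> d"
    by auto
qed

lemma continuous_on_peval: "continuous_on S (peval P)"
  unfolding peval_def by (intro continuous_intros)

text \<open>
  Every line through a point \<open>x0\<close> that is not a zero contains only finitely many zeros. Summing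
  over all lines, Fubini's theorem shows that almost every homothetic copy of the zero set
  with centre \<open>x0\<close> is null, and homothetic copies are null only together.
\<close>

lemma negligible_zeros:
  fixes P :: "'n::finite rpoly"
  assumes "total_degree_le P d" and "peval P x0 \<noteq> 0"
  shows "negligible {x. peval P x = 0}"
proof -
  let ?Z = "\<lambda>t y. x0 + t *\<^sub>R y \<in> {x. peval P x = 0}"
  have cl: "closed {x. peval P x = 0}"
    by (intro closed_Collect_eq continuous_on_peval continuous_intros)
  have cont: "continuous_on UNIV (\<lambda>(t, y). x0 + t *\<^sub>R y)"
    by (auto simp: case_prod_unfold intro!: continuous_intros)
  have clp: "closed {(t::real, y). ?Z t y}"
    using closed_vimage[OF cl cont] by (simp add: vimage_def case_prod_unfold)
  have meas: "(\<lambda>(t, y). indicator {(t::real, y). ?Z t y} (t, y) :: ennreal)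
      \<in> borel_measurable (lborel \<Otimes>\<^sub>M lborel)"
    using clp by (simp add: lborel_prod case_prod_unfold)
  have "(\<integral>\<^sup>+ t. (\<integral>\<^sup>+ y. indicator {(t::real, y). ?Z t y} (t, y) \<partial>lborel) \<partial>lborel)
      = (\<integral>\<^sup>+ y. (\<integral>\<^sup>+ t. indicator {(t::real, y). ?Z t y} (t, y) \<partial>lborel) \<partial>lborel)"
    using lborel_pair.Fubini'[OF meas] by simp
  also have "\<dots> = (\<integral>\<^sup>+ (y::real^'n). 0 \<partial>lborel)"
  proof (rule nn_integral_cong)
    fix y :: "real^'n"
    have fin: "finite {t. peval P (x0 + t *\<^sub>R y) = 0}"
      using zeros_on_line(1)[OF assms(1), of x0 0 y] assms(2) by simp
    have "(\<integral>\<^sup>+ t. indicator {(t::real, y). ?Z t y} (t, y) \<partial>lborel)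
        = (\<integral>\<^sup>+ t. indicator {t. peval P (x0 + t *\<^sub>R y) = 0} t \<partial>lborel)"
      by (intro nn_integral_cong) (auto simp: indicator_def)
    also have "\<dots> = emeasure lborel {t. peval P (x0 + t *\<^sub>R y) = 0}"
      using fin by (intro nn_integral_indicator) (simp add: borel_closed finite_imp_closed)
    also have "\<dots> = 0"
      using fin by (rule emeasure_lborel_countable[OF countable_finite])
    finally show "(\<integral>\<^sup>+ t. indicator {(t::real, y). ?Z t y} (t, y) \<partial>lborel) = 0" .
  qed
  finally have int0: "(\<integral>\<^sup>+ t. (\<integral>\<^sup>+ y. indicator {(t::real, y). ?Z t y} (t, y) \<partial>lborel) \<partial>lborel) = 0"
    by simp
  have "(\<lambda>t. \<integral>\<^sup>+ y. indicator {(t::real, y). ?Z t y} (t, y) \<partial>lborel) \<in> borel_measurable lborel"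
    using lborel.borel_measurable_nn_integral[OF meas] by simp
  then have "AE t in lborel. (\<integral>\<^sup>+ y. indicator {(t::real, y). ?Z t y} (t, y) \<partial>lborel) = 0"
    using int0 by (simp add: nn_integral_0_iff_AE)
  moreover have "AE t::real in lborel. t \<noteq> 0"
    by (rule AE_lborel_singleton)
  ultimately have "AE t in lborel. t \<noteq> 0 \<and>
      (\<integral>\<^sup>+ y. indicator {(t::real, y). ?Z t y} (t, y) \<partial>lborel) = 0"
    by eventually_elim (rule conjI)
  moreover have "ae_filter (lborel :: real measure) \<noteq> bot"
    by (simp add: ae_filter_eq_bot_iff)
  ultimately obtain t :: real where t: "t \<noteq> 0"
      "(\<integral>\<^sup>+ y. indicator {(t::real, y). ?Z t y} (t, y) \<partial>lborel) = 0"
    using eventually_happens' by blast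
  have cl1: "closed {y. ?Z t y}"
    using closed_vimage[OF cl, of "\<lambda>y. x0 + t *\<^sub>R y"]
    by (simp add: vimage_def continuous_intros)
  have "emeasure lborel {y. ?Z t y} = (\<integral>\<^sup>+ y. indicator {y. ?Z t y} y \<partial>lborel)"
    using cl1 by simp
  also have "\<dots> = 0"
    using t(2) by (simp add: indicator_def)
  finally have "{y. ?Z t y} \<in> null_sets lborel"
    using cl1 by (auto simp: null_sets_def)
  then have "negligible {y. ?Z t y}"
    using negligible_iff_null_sets null_sets_completionI by blast
  then have "negligible ((+) x0 ` ((*\<^sub>R) t ` {y. ?Z t y}))"
    by (intro negligible_translation negligible_differentiable_image_negligible)
       (auto intro!: derivative_intros)
  moreover have "{x. peval P x = 0} \<subseteq> (+) x0 ` ((*\<^sub>R) t ` {y. ?Z t y})"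
  proof
    fix x assume "x \<in> {x. peval P x = 0}"
    then have "?Z t ((1/t) *\<^sub>R (x - x0))" and "x = x0 + t *\<^sub>R ((1/t) *\<^sub>R (x - x0))"
      using t(1) by auto
    then show "x \<in> (+) x0 ` ((*\<^sub>R) t ` {y. ?Z t y})"
      by blast
  qed
  ultimately show ?thesis
    by (rule negligible_subset)
qed

section \<open>Definiteness and polynomials vanishing on a set\<close>

text \<open>
  This is Gaussian elimination: if \<open>f i z \<noteq> 0\<close> for some \<open>z \<in> Z\<close>, then subtracting
  multiples of \<open>f i\<close> from the other functions makes them vanish at \<open>z\<close>. A combination of the \<open>f j\<close>
  is a combination of these fewer functions plus a multiple of \<open>f i\<close> whose coefficient
  is controlled by the value at \<open>z\<close>. If no such \<open>i\<close> exists, all combinations vanish on \<open>Z\<close>,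
  hence on \<open>X\<close>.
  The scale \<open>A\<close> is carried along because the bound on \<open>Z\<close> changes in each step.
\<close>

lemma uniform_bound_of_unisolvence:
  fixes f :: "'i \<Rightarrow> 'a \<Rightarrow> real"
  assumes "finite I" and "Z \<subseteq> X"
    and "\<And>i. i \<in> I \<Longrightarrow> \<exists>B. \<forall>x\<in>X. \<bar>f i x\<bar> \<le> B"
    and "\<And>c. \<forall>z\<in>Z. (\<Sum>i\<in>I. c i * f i z) = 0 \<Longrightarrow> \<forall>x\<in>X. (\<Sum>i\<in>I. c i * f i x) = 0"
  shows "\<exists>K\<ge>0. \<forall>c A. A \<ge> 0 \<longrightarrow> (\<forall>z\<in>Z. \<bar>\<Sum>i\<in>I. c i * f i z\<bar> \<le> A) \<longrightarrow>
           (\<forall>x\<in>X. \<bar>\<Sum>i\<in>I. c i * f i x\<bar> \<le> K * A)"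
  using assms(1,3,4)
proof (induction "card I" arbitrary: I f)
  case 0
  then show ?case by (intro exI[of _ 0]) auto
next
  case (Suc k)
  show ?case
  proof (cases "\<exists>i\<in>I. \<exists>z\<in>Z. f i z \<noteq> 0")
    case False
    then have "\<forall>x\<in>X. (\<Sum>i\<in>I. c i * f i x) = 0" for c
      by (intro Suc.prems(3)) simp
    then show ?thesis by (intro exI[of _ 0]) auto
  next
    case True
    then obtain i z where i: "i \<in> I" "z \<in> Z" "f i z \<noteq> 0" by auto
    define g where "g j x = f j x - f j z / f i z * f i x" for j x
    let ?J = "I - {i}"
    have split: "(\<Sum>j\<in>I. c j * f j x) = (\<Sum>j\<in>?J. c j * g j x) + (\<Sum>j\<in>I. c j * f j z) / f i z * f i x"
      for c x
    proof -
      have "(\<Sum>j\<in>?J. c j * g j x) = (\<Sum>j\<in>I. c j * g j x)"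
        using Suc.prems(1) i by (simp add: sum.remove[of I i] g_def)
      also have "\<dots> = (\<Sum>j\<in>I. c j * f j x) - (\<Sum>j\<in>I. c j * f j z) / f i z * f i x"
        by (simp add: g_def algebra_simps sum_subtractf sum_distrib_left sum_divide_distrib)
      finally show ?thesis by simp
    qed
    obtain B where B: "\<forall>x\<in>X. \<bar>f i x\<bar> \<le> B"
      using Suc.prems(2) i by blast
    have B0: "B \<ge> 0" using B i \<open>Z \<subseteq> X\<close> by fastforce
    have "\<exists>K\<ge>0. \<forall>c A. A \<ge> 0 \<longrightarrow> (\<forall>z\<in>Z. \<bar>\<Sum>j\<in>?J. c j * g j z\<bar> \<le> A) \<longrightarrow>
           (\<forall>x\<in>X. \<bar>\<Sum>j\<in>?J. c j * g j x\<bar> \<le> K * A)"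
    proof (rule Suc.hyps(1))
      show "k = card ?J" using Suc.hyps(2) i Suc.prems(1) by simp
      show "finite ?J" using Suc.prems(1) by simp
      fix j assume "j \<in> ?J"
      then obtain B' where B': "\<forall>x\<in>X. \<bar>f j x\<bar> \<le> B'" using Suc.prems(2) by blast
      have "\<bar>g j x\<bar> \<le> B' + \<bar>f j z / f i z\<bar> * B" if "x \<in> X" for x
      proof -
        have "\<bar>g j x\<bar> \<le> \<bar>f j x\<bar> + \<bar>f j z / f i z * f i x\<bar>"
          unfolding g_def by (rule abs_triangle_ineq4)
        also have "\<bar>f j z / f i z * f i x\<bar> = \<bar>f j z / f i z\<bar> * \<bar>f i x\<bar>" by (rule abs_mult)
        also have "\<dots> \<le> \<bar>f j z / f i z\<bar> * B" using B that by (intro mult_left_mono) auto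
        finally show ?thesis using B' that by force
      qed
      then show "\<exists>B. \<forall>x\<in>X. \<bar>g j x\<bar> \<le> B" by blast
    next
      fix c assume c: "\<forall>z\<in>Z. (\<Sum>j\<in>?J. c j * g j z) = 0"
      \<comment> \<open>The coefficient at \<open>i\<close> is chosen so that the combination of the \<open>f j\<close> vanishes at \<open>z\<close>;
        then it equals the given combination of the \<open>g j\<close> everywhere.\<close>
      define c' where "c' = c(i := - (\<Sum>j\<in>?J. c j * f j z) / f i z)"
      have "(\<Sum>j\<in>I. c' j * f j z) = 0"
        using Suc.prems(1) i by (simp add: sum.remove[of I i] c'_def)
      then have eq: "(\<Sum>j\<in>I. c' j * f j x) = (\<Sum>j\<in>?J. c j * g j x)" for x
        using split[of c' x] by (simp add: c'_def)
      show "\<forall>x\<in>X. (\<Sum>j\<in>?J. c j * g j x) = 0"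
        using Suc.prems(3)[of c'] c unfolding eq by blast
    qed
    then obtain K where K: "K \<ge> 0" "\<And>c A x. A \<ge> 0 \<Longrightarrow> (\<forall>z\<in>Z. \<bar>\<Sum>j\<in>?J. c j * g j z\<bar> \<le> A)
           \<Longrightarrow> x \<in> X \<Longrightarrow> \<bar>\<Sum>j\<in>?J. c j * g j x\<bar> \<le> K * A" by blast
    define D where "D = B / \<bar>f i z\<bar>"
    have D0: "D \<ge> 0" using B0 by (simp add: D_def)
    show ?thesis
    proof (intro exI[of _ "K * (1 + D) + D"] conjI allI impI ballI)
      show "0 \<le> K * (1 + D) + D" using K(1) D0 by simp
      fix c A x assume A: "A \<ge> 0" "\<forall>z\<in>Z. \<bar>\<Sum>i\<in>I. c i * f i z\<bar> \<le> A" and x: "x \<in> X"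
      have corr: "\<bar>(\<Sum>j\<in>I. c j * f j z) / f i z * f i y\<bar> \<le> D * A" if "y \<in> X" for y
      proof -
        have "\<bar>\<Sum>j\<in>I. c j * f j z\<bar> * \<bar>f i y\<bar> \<le> A * B"
          using A B that i by (intro mult_mono) auto
        then have "\<bar>\<Sum>j\<in>I. c j * f j z\<bar> * \<bar>f i y\<bar> / \<bar>f i z\<bar> \<le> A * B / \<bar>f i z\<bar>"
          by (rule divide_right_mono) simp
        then show ?thesis by (simp add: D_def abs_mult mult.commute)
      qed
      have "\<bar>\<Sum>j\<in>?J. c j * g j w\<bar> \<le> (1 + D) * A" if "w \<in> Z" for w
      proof -
        have "w \<in> X" using that assms(2) by blast
        have "\<bar>\<Sum>j\<in>?J. c j * g j w\<bar> \<le> \<bar>\<Sum>j\<in>I. c j * f j w\<bar> + \<bar>(\<Sum>j\<in>I. c j * f j z) / f i z * f i w\<bar>"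
          using split[of c w] by linarith
        then show ?thesis
          using corr[OF \<open>w \<in> X\<close>] A(2) that by (force simp: algebra_simps)
      qed
      then have "\<bar>\<Sum>j\<in>?J. c j * g j x\<bar> \<le> K * ((1 + D) * A)"
        using A D0 x by (intro K(2)) auto
      then show "\<bar>\<Sum>i\<in>I. c i * f i x\<bar> \<le> (K * (1 + D) + D) * A"
        using split[of c x] corr[OF x] abs_triangle_ineq[of "\<Sum>j\<in>?J. c j * g j x"
            "(\<Sum>j\<in>I. c j * f j z) / f i z * f i x"]
        unfolding distrib_right[of _ _ A] mult.assoc[of K] by linarith
    qed
  qed
qed

definition monomials_upto :: "nat \<Rightarrow> ('n::finite \<Rightarrow>\<^sub>0 nat) set" where
  "monomials_upto d = {m. (\<Sum>i\<in>UNIV. Poly_Mapping.lookup m i) \<le> d}"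

lemma finite_monomials_upto: "finite (monomials_upto d :: ('n::finite \<Rightarrow>\<^sub>0 nat) set)"
proof (rule finite_imageD)
  show "inj_on Poly_Mapping.lookup (monomials_upto d :: ('n \<Rightarrow>\<^sub>0 nat) set)"
    by (auto intro: inj_onI poly_mapping_eqI)
  have "Poly_Mapping.lookup m i \<le> d" if "m \<in> monomials_upto d" for m :: "'n \<Rightarrow>\<^sub>0 nat" and i
    using that member_le_sum[of i UNIV "Poly_Mapping.lookup m"] by (simp add: monomials_upto_def)
  then have "Poly_Mapping.lookup ` (monomials_upto d :: ('n \<Rightarrow>\<^sub>0 nat) set) \<subseteq> (\<Pi>\<^sub>E i\<in>UNIV. {..d})"
    by auto
  then show "finite (Poly_Mapping.lookup ` (monomials_upto d :: ('n \<Rightarrow>\<^sub>0 nat) set))"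
    by (rule finite_subset) (auto intro!: finite_PiE)
qed

lemma peval_eq_sum_monomials_upto:
  assumes "total_degree_le P d"
  shows "peval P x = (\<Sum>m\<in>monomials_upto d. Poly_Mapping.lookup P m * (\<Prod>i\<in>UNIV. (x $ i) ^ Poly_Mapping.lookup m i))"
  unfolding peval_def
proof (rule sum.mono_neutral_left[OF finite_monomials_upto])
  show "Poly_Mapping.keys P \<subseteq> monomials_upto d"
    using assms by (auto simp: total_degree_le_def monomials_upto_def)
qed (simp add: in_keys_iff)

lemma polynomial_with_coefficients:
  fixes c :: "('n::finite \<Rightarrow>\<^sub>0 nat) \<Rightarrow> real"
  obtains P :: "'n rpoly" where "total_degree_le P d"
    "\<And>m. m \<in> monomials_upto d \<Longrightarrow> Poly_Mapping.lookup P m = c m"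
proof
  let ?c = "\<lambda>m. if m \<in> monomials_upto d then c m else 0"
  have "finite {m. ?c m \<noteq> 0}"
    by (rule finite_subset[OF _ finite_monomials_upto[of d]]) auto
  then have lk: "Poly_Mapping.lookup (Abs_poly_mapping ?c) = ?c"
    by (rule lookup_Abs_poly_mapping)
  show "total_degree_le (Abs_poly_mapping ?c) d"
    by (auto simp: total_degree_le_def in_keys_iff lk split: if_splits) (simp add: monomials_upto_def)
  show "Poly_Mapping.lookup (Abs_poly_mapping ?c) m = c m" if "m \<in> monomials_upto d" for m
    using that by (simp add: lk)
qed

text \<open>
  The monomials are bounded by 1 on the unit cube, so the elimination argument applies to them.
\<close>

lemma vanishing_polynomial_if_not_d_definite:
  fixes Z :: "(real^'n::finite) set"
  assumes "Z \<subseteq> unit_cube" and "\<not> d_definite d Z"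
  obtains P x0 where "total_degree_le P d" "\<forall>z\<in>Z. peval P z = 0" "peval P x0 \<noteq> 0"
proof (rule ccontr)
  assume "\<not> thesis"
  then have none: "\<And>P x. total_degree_le P d \<Longrightarrow> \<forall>z\<in>Z. peval P z = 0 \<Longrightarrow> peval P x = 0"
    using that by blast
  let ?f = "\<lambda>m (x::real^'n). \<Prod>i\<in>UNIV. (x $ i) ^ Poly_Mapping.lookup m i"
  have "\<exists>K\<ge>0. \<forall>c A. A \<ge> 0 \<longrightarrow> (\<forall>z\<in>Z. \<bar>\<Sum>m\<in>monomials_upto d. c m * ?f m z\<bar> \<le> A) \<longrightarrow>
           (\<forall>x\<in>unit_cube. \<bar>\<Sum>m\<in>monomials_upto d. c m * ?f m x\<bar> \<le> K * A)"
  proof (rule uniform_bound_of_unisolvence[OF finite_monomials_upto assms(1)])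
    fix m :: "'n \<Rightarrow>\<^sub>0 nat"
    have "\<bar>?f m x\<bar> \<le> 1" if "x \<in> unit_cube" for x
      using that by (auto simp: abs_prod power_abs unit_cube_def intro!: prod_le_1 power_le_one)
    then show "\<exists>B. \<forall>x\<in>unit_cube. \<bar>?f m x\<bar> \<le> B" by blast
  next
    fix c :: "('n \<Rightarrow>\<^sub>0 nat) \<Rightarrow> real"
    assume c: "\<forall>z\<in>Z. (\<Sum>m\<in>monomials_upto d. c m * ?f m z) = 0"
    obtain P where P: "total_degree_le P d"
      "\<And>m. m \<in> monomials_upto d \<Longrightarrow> Poly_Mapping.lookup P m = c m"
      using polynomial_with_coefficients by blast
    have "peval P x = (\<Sum>m\<in>monomials_upto d. c m * ?f m x)" for x
      using P by (simp add: peval_eq_sum_monomials_upto cong: sum.cong)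
    then show "\<forall>x\<in>unit_cube. (\<Sum>m\<in>monomials_upto d. c m * ?f m x) = 0"
      using none[OF P(1)] c by simp
  qed
  then obtain K where K: "\<forall>c A. A \<ge> 0 \<longrightarrow> (\<forall>z\<in>Z. \<bar>\<Sum>m\<in>monomials_upto d. c m * ?f m z\<bar> \<le> A) \<longrightarrow>
           (\<forall>x\<in>unit_cube. \<bar>\<Sum>m\<in>monomials_upto d. c m * ?f m x\<bar> \<le> K * A)" by blast
  have "\<bar>peval P x\<bar> \<le> K" if "total_degree_le P d" "\<forall>z\<in>Z. \<bar>peval P z\<bar> \<le> 1" "x \<in> unit_cube" for P x
    using K[rule_format, of 1 "Poly_Mapping.lookup P" x] that by (simp add: peval_eq_sum_monomials_upto)
  then have "d_definite d Z" unfolding d_definite_def by blast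
  with assms(2) show False ..
qed

section \<open>Bounding Hausdorff measure by coverings with cubes\<close>

definition cube :: "real^'n::finite \<Rightarrow> real \<Rightarrow> (real^'n) set" where
  "cube a e = {x. \<forall>i. a $ i \<le> x $ i \<and> x $ i \<le> a $ i + e}"

lemma cube_dist_le:
  fixes a :: "real^'n::finite"
  assumes "x \<in> cube a e" "y \<in> cube a e"
  shows "dist x y \<le> sqrt (real CARD('n)) * e"
proof -
  have d: "\<bar>x $ i - y $ i\<bar> \<le> e" for i
    using assms by (auto simp: cube_def abs_le_iff) (smt (verit))+
  then have "0 \<le> e" using abs_ge_zero order_trans by blast
  have "dist x y = sqrt (\<Sum>i\<in>UNIV. (x $ i - y $ i)\<^sup>2)"
    by (simp add: dist_norm norm_vec_def L2_set_def)
  also have "\<dots> \<le> sqrt (\<Sum>i\<in>(UNIV::'n set). e\<^sup>2)"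
    using d by (intro real_sqrt_le_mono sum_mono) (simp add: abs_le_square_iff[symmetric] \<open>0 \<le> e\<close>)
  also have "\<dots> = sqrt (real CARD('n)) * e"
    using \<open>0 \<le> e\<close> by (simp add: real_sqrt_mult)
  finally show ?thesis .
qed

lemma hausdorff_content_le_cubes:
  fixes Z :: "(real^'n::finite) set"
  assumes "finite S" "Z \<subseteq> (\<Union>a\<in>S. cube a e)" "0 \<le> e"
  shows "hausdorff_content \<beta> (sqrt (real CARD('n)) * e) Z
    \<le> ennreal (real (card S) * hpow (sqrt (real CARD('n)) * e) \<beta>)"
proof -
  let ?r = "sqrt (real CARD('n)) * e"
  obtain h where h: "bij_betw h {0..<card S} S"
    using ex_bij_betw_nat_finite[OF assms(1)] by blast
  have "bounded (cube a e) \<and> diameter (cube a e) \<le> ?r" for a :: "real^'n"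
  proof
    have "dist a x \<le> ?r" if "x \<in> cube a e" for x
      by (rule cube_dist_le[OF _ that]) (simp add: cube_def assms(3))
    then show "bounded (cube a e)" unfolding bounded_def by blast
    show "diameter (cube a e) \<le> ?r"
      by (rule diameter_le) (use cube_dist_le assms(3) in \<open>auto simp: dist_norm\<close>)
  qed
  moreover have "Z \<subseteq> (\<Union>i\<in>{0..<card S}. cube (h i) e)"
    using assms(2) arg_cong[OF bij_betw_imp_surj_on[OF h], of "\<lambda>T. \<Union>a\<in>T. cube a e"]
    by (simp only: image_image)
  ultimately have "hausdorff_content \<beta> ?r Z \<le> (\<Sum>\<^sub>\<infinity>i\<in>{0..<card S}. ennreal (hpow ?r \<beta>))"
    unfolding hausdorff_content_def
    by (intro Inf_lower CollectI exI[of _ "{0..<card S}"] exI[of _ "\<lambda>i. cube (h i) e"]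
        exI[of _ "\<lambda>_. ?r"]) auto
  also have "\<dots> = ennreal (real (card S) * hpow ?r \<beta>)"
    by (simp add: ennreal_mult' hpow_def ennreal_of_nat_eq_real_of_nat)
  finally show ?thesis .
qed

lemma hausdorff_measure_le_limit:
  fixes \<alpha> g :: "'b \<Rightarrow> real"
  assumes "F \<noteq> bot" "filterlim \<alpha> (at_right 0) F" "(g \<longlongrightarrow> L) F"
    and "\<forall>\<^sub>F k in F. hausdorff_content \<beta> (\<alpha> k) Z \<le> ennreal (g k)"
  shows "hausdorff_measure \<beta> Z \<le> ennreal L"
  unfolding hausdorff_measure_eq_SUP
  by (rule tendsto_le[OF assms(1) tendsto_ennrealI[OF assms(3)]
        filterlim_compose[OF hausdorff_content_tendsto assms(2)] assms(4)])

section \<open>Zero sets under Vitushkin's bound\<close>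

text \<open>
  The covering number is a least element, so it is meaningful only once some finite
  cover is known to exist; compactness of the unit cube provides one.
\<close>

lemma covering_number_attained:
  fixes A :: "(real^'n::finite) set"
  assumes "A \<subseteq> unit_cube" "e > 0"
  obtains S where "finite S" "card S = covering_number e A" "A \<subseteq> (\<Union>a\<in>S. cube a e)"
proof -
  have "compact (unit_cube :: (real^'n) set)"
  proof -
    have "(unit_cube :: (real^'n) set) = cbox 0 1"
      by (auto simp: unit_cube_def mem_box_cart)
    then show ?thesis by (rule ssubst) (rule compact_cbox)
  qed
  moreover have "(unit_cube :: (real^'n) set) \<subseteq> (\<Union>a\<in>unit_cube. interior (cube (a - (\<chi> i. e / 2)) e))"
  proof
    fix a :: "real^'n" assume "a \<in> unit_cube"
    have "a \<in> box (a - (\<chi> i. e / 2)) (a + (\<chi> i. e / 2))"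
      using assms(2) by (simp add: mem_box_cart)
    moreover have "box (a - (\<chi> i. e / 2)) (a + (\<chi> i. e / 2)) \<subseteq> interior (cube (a - (\<chi> i. e / 2)) e)"
    proof (rule interior_maximal)
      show "box (a - (\<chi> i. e / 2)) (a + (\<chi> i. e / 2)) \<subseteq> cube (a - (\<chi> i. e / 2)) e"
        by (auto simp: cube_def mem_box_cart) (smt (verit) field_sum_of_halves less_imp_le)+
    qed (rule open_box)
    ultimately show "a \<in> (\<Union>a\<in>unit_cube. interior (cube (a - (\<chi> i. e / 2)) e))"
      using \<open>a \<in> unit_cube\<close> by blast
  qed
  ultimately obtain D where D: "D \<subseteq> unit_cube" "finite D"
      "unit_cube \<subseteq> (\<Union>a\<in>D. interior (cube (a - (\<chi> i. e / 2)) e :: (real^'n) set))"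
    by (auto elim: compactE_image[where f = "\<lambda>a. interior (cube (a - (\<chi> i. e / 2)) e)"])
  let ?S = "(\<lambda>a. a - (\<chi> i. e / 2)) ` D"
  have "A \<subseteq> (\<Union>a\<in>?S. cube a e)"
    using assms(1) D(3) interior_subset by (fastforce simp: subset_iff)
  then have "\<exists>k S. finite S \<and> card S = k \<and> A \<subseteq> (\<Union>a\<in>S. cube a e)"
    using D(2) by (intro exI[of _ "card ?S"] exI[of _ ?S]) auto
  then have "\<exists>S. finite S \<and> card S = covering_number e A \<and> A \<subseteq> (\<Union>a\<in>S. cube a e)"
    unfolding covering_number_def cube_def by (rule LeastI_ex)
  then show thesis using that by blast
qed

lemma hausdorff_measure_zeros_le:
  fixes P :: "'n::finite rpoly"
  assumes C: "vitushkin_constants TYPE('n) d C" and P: "total_degree_le P d" "peval P x0 \<noteq> 0"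
    and Z: "Z \<subseteq> unit_cube" "\<forall>z\<in>Z. peval P z = 0"
  shows "hausdorff_measure (real (CARD('n) - 1)) Z
     \<le> ennreal (sqrt (real CARD('n) ^ (CARD('n) - 1)) * C (CARD('n) - 1))"
proof -
  define n where "n = CARD('n)"
  have n: "n \<ge> 1" by (simp add: n_def Suc_leI)
  let ?s = "sqrt (real n)"
  have s: "?s > 0" using n by simp
  define g where "g e = (\<Sum>i<n. C i * e ^ (n - 1 - i)) * ?s ^ (n - 1)" for e :: real
  have sub: "Z \<subseteq> sublevel_set 0 P" using Z by (auto simp: sublevel_set_def)
  have "negligible (sublevel_set 0 P)"
    by (rule negligible_subset[OF negligible_zeros[OF P]]) (auto simp: sublevel_set_def)
  then have null: "measure lebesgue (sublevel_set 0 P) = 0"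
    by (simp add: negligible_imp_measure0)
  have cont: "hausdorff_content (real (n - 1)) (?s * e) Z \<le> ennreal (g e)" if e: "e > 0" for e
  proof -
    obtain S where S: "finite S" "card S = covering_number e (sublevel_set 0 P)"
        "sublevel_set 0 P \<subseteq> (\<Union>a\<in>S. cube a e)"
      by (rule covering_number_attained[of "sublevel_set 0 P" e])
         (use e in \<open>auto simp: sublevel_set_def\<close>)
    have "hausdorff_content (real (n - 1)) (?s * e) Z
        \<le> ennreal (real (card S) * hpow (?s * e) (real (n - 1)))"
      unfolding n_def using hausdorff_content_le_cubes[OF S(1), of Z e "real (n - 1)"] S(3) sub e
      by (auto simp: n_def)
    also have "hpow (?s * e) (real (n - 1)) = (?s * e) ^ (n - 1)"
    by (simp only: hpow_def powr_realpow[OF mult_pos_pos[OF s e]] of_nat_eq_0_iff) simp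
    also have "real (card S) * (?s * e) ^ (n - 1) \<le> (\<Sum>i<n. C i / e ^ i) * (?s * e) ^ (n - 1)"
    proof (rule mult_right_mono)
      have "real (covering_number e (sublevel_set 0 P))
          \<le> (\<Sum>i<CARD('n). C i / e ^ i) + measure lebesgue (sublevel_set 0 P) / e ^ CARD('n)"
        using C P(1) e unfolding vitushkin_constants_def by (meson order_refl)
      then show "real (card S) \<le> (\<Sum>i<n. C i / e ^ i)"
        by (simp add: S(2) null n_def)
    qed (use s e in simp)
    also have "\<dots> = g e"
    proof -
      have "C i / e ^ i * e ^ (n - 1) = C i * e ^ (n - 1 - i)" if "i < n" for i
        using that e by (simp add: power_diff)
      then have "(\<Sum>i<n. C i / e ^ i * e ^ (n - 1)) = (\<Sum>i<n. C i * e ^ (n - 1 - i))"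
        by (intro sum.cong) auto
      then have "(\<Sum>i<n. C i / e ^ i) * e ^ (n - 1) = (\<Sum>i<n. C i * e ^ (n - 1 - i))"
        by (simp only: sum_distrib_right)
      then show ?thesis
        by (simp only: g_def power_mult_distrib) (simp add: mult.left_commute mult.commute)
    qed
    finally show ?thesis by (simp add: ennreal_leI)
  qed
  have "(g \<longlongrightarrow> (\<Sum>i<n. C i * 0 ^ (n - 1 - i)) * ?s ^ (n - 1)) (at_right 0)"
    unfolding g_def by (intro tendsto_intros)
  also have "(\<Sum>i<n. C i * 0 ^ (n - 1 - i)) = C (n - 1)"
  proof -
    have "(\<Sum>i<n. C i * 0 ^ (n - 1 - i)) = (\<Sum>i<n. if i = n - 1 then C i else 0)"
      by (rule sum.cong) auto
    then show ?thesis using n by simp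
  qed
  finally have lim: "(g \<longlongrightarrow> C (n - 1) * ?s ^ (n - 1)) (at_right 0)" .
  have "filterlim (\<lambda>e. ?s * e) (at_right 0) (at_right 0)"
    unfolding filterlim_at
  proof
    have "((\<lambda>e. ?s * e) \<longlongrightarrow> ?s * 0) (at_right 0)" by (intro tendsto_intros)
    then show "((\<lambda>e. ?s * e) \<longlongrightarrow> 0) (at_right 0)" by simp
    show "\<forall>\<^sub>F e in at_right 0. ?s * e \<in> {0<..} \<and> ?s * e \<noteq> 0"
      using eventually_at_right_less[of "0::real"] by eventually_elim (use s in auto)
  qed
  then have "hausdorff_measure (real (n - 1)) Z \<le> ennreal (C (n - 1) * ?s ^ (n - 1))"
  proof (rule hausdorff_measure_le_limit[OF trivial_limit_at_right_real _ lim])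
    show "\<forall>\<^sub>F e in at_right 0. hausdorff_content (real (n - 1)) (?s * e) Z \<le> ennreal (g e)"
      using eventually_at_right_less[of "0::real"] by eventually_elim (rule cont)
  qed
  then show ?thesis by (simp add: n_def real_sqrt_power mult.commute)
qed

section \<open>Connected subsets of plane algebraic curves\<close>

text \<open>
  Addition on the index type \<open>2\<close> is modulo 2, so \<open>k + 1\<close> is the coordinate other than \<open>k\<close>, and
  the line through \<open>q\<close> in this direction is the one on which coordinate \<open>k\<close> is constant.
\<close>

lemma zeros_on_axis_parallel_line:
  fixes P :: "2 rpoly"
  assumes "total_degree_le P d" "peval P q \<noteq> 0"
  shows "finite {x. x $ k = q $ k \<and> peval P x = 0}" "card {x. x $ k = q $ k \<and> peval P x = 0} \<le> d"
proof -
  let ?T = "{t. peval P (q + t *\<^sub>R axis (k + 1) 1) = 0}"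
  have T: "finite ?T" "card ?T \<le> d"
    using zeros_on_line[OF assms(1), of q 0] assms(2) by auto
  have "{x. x $ k = q $ k \<and> peval P x = 0} \<subseteq> (\<lambda>t. q + t *\<^sub>R axis (k + 1) 1) ` ?T"
  proof
    fix x assume x: "x \<in> {x. x $ k = q $ k \<and> peval P x = 0}"
    have other: "j = k" if "j \<noteq> k + 1" for j :: 2
      using that exhaust_2[of j] exhaust_2[of k] by auto
    have "x = q + (x $ (k + 1) - q $ (k + 1)) *\<^sub>R axis (k + 1) 1"
    proof (rule vec_eq_iff[THEN iffD2], rule allI)
      fix j
      show "x $ j = (q + (x $ (k + 1) - q $ (k + 1)) *\<^sub>R axis (k + 1) 1) $ j"
        using x other[of j] by (cases "j = k + 1") (simp_all add: axis_def)
    qed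
    then show "x \<in> (\<lambda>t. q + t *\<^sub>R axis (k + 1) 1) ` ?T" using x by force
  qed
  then show "finite {x. x $ k = q $ k \<and> peval P x = 0}" "card {x. x $ k = q $ k \<and> peval P x = 0} \<le> d"
    using T(1) surj_card_le[OF T(1), THEN order_trans, OF _ T(2)]
    by (blast intro: finite_subset)+
qed

text \<open>
  Enlarging the squares from edge \<open>1/N\<close> to \<open>2/N\<close> makes it possible to centre them at the zeros on
  the grid lines, so that counting zeros is enough and the cells need not be
  counted. The summand 1 accounts for a set contained in a single cell, which may avoid all
  grid lines.
\<close>

lemma cover_connected_zeros:
  fixes P :: "2 rpoly" and N :: nat
  assumes P: "total_degree_le P d" "peval P x0 \<noteq> 0" and N: "N \<ge> 1"
    and Z: "connected Z" "Z \<subseteq> unit_cube" "\<forall>z\<in>Z. peval P z = 0"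
  obtains S where "finite S" "card S \<le> 2 * (N + 2) * d + 1" "Z \<subseteq> (\<Union>a\<in>S. cube a (2 / N))"
proof -
  define q :: "2 \<Rightarrow> real \<Rightarrow> real^2" where "q k u = x0 + (u - x0 $ k) *\<^sub>R axis k 1" for k u
  have qk: "q k u $ k = u" for k u by (simp add: q_def)
  \<comment> \<open>The line on which coordinate \<open>k\<close> equals \<open>u\<close> passes through \<open>q k u\<close>. If \<open>u\<close> is not bad, this
    point shows that \<open>P\<close> does not vanish identically on the line.\<close>
  define bad where "bad = {u. \<exists>k. peval P (q k u) = 0}"
  have "finite {u. peval P (q k u) = 0}" for k
  proof -
    have "finite {t. peval P (x0 + t *\<^sub>R axis k 1) = 0}"
      using zeros_on_line(1)[OF P(1), of x0 0] P(2) by simp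
    then have "finite ((\<lambda>t. t + x0 $ k) ` {t. peval P (x0 + t *\<^sub>R axis k 1) = 0})"
      by simp
    moreover have "{u. peval P (q k u) = 0}
        \<subseteq> (\<lambda>t. t + x0 $ k) ` {t. peval P (x0 + t *\<^sub>R axis k 1) = 0}"
    proof
      fix u assume "u \<in> {u. peval P (q k u) = 0}"
      then show "u \<in> (\<lambda>t. t + x0 $ k) ` {t. peval P (x0 + t *\<^sub>R axis k 1) = 0}"
        by (intro image_eqI[of _ _ "u - x0 $ k"]) (auto simp: q_def)
    qed
    ultimately show ?thesis by (rule finite_subset[rotated])
  qed
  moreover have "bad = (\<Union>k. {u. peval P (q k u) = 0})" by (auto simp: bad_def)
  ultimately have "finite bad" by simp
  \<comment> \<open>A shift \<open>s\<close> puts the \<open>i\<close>-th grid value at the bad \<open>u\<close> exactly if \<open>s = u * N - i\<close>. The indices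
    run from \<open>-1\<close> so that the shifted cells still cover \<open>[0, 1]\<close>.\<close>
  then have "finite ((\<lambda>(u, i::int). u * N - i) ` (bad \<times> {-1..int N}))" by simp
  then have "infinite ({0<..<1} - (\<lambda>(u, i::int). u * N - i) ` (bad \<times> {-1..int N}))"
    by (intro Diff_infinite_finite) (simp_all add: infinite_Ioo)
  then obtain s :: real where s: "0 < s" "s < 1"
      "s \<notin> (\<lambda>(u, i::int). u * N - i) ` (bad \<times> {-1..int N})"
    by (metis (no_types, lifting) DiffE equals0I finite.emptyI greaterThanLessThan_iff)
  define G where "G = (\<lambda>i::int. (i + s) / N) ` {-1..int N}"
  have G: "finite G" "card G \<le> N + 2"
    unfolding G_def using card_image_le[of "{-1..int N}" "\<lambda>i::int. (i + s) / N"] by auto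
  have good: "peval P (q k u) \<noteq> 0" if u: "u \<in> G" for k u
  proof
    assume "peval P (q k u) = 0"
    then have "u \<in> bad" by (auto simp: bad_def)
    obtain i :: int where i: "i \<in> {-1..int N}" "u = (i + s) / N" using u by (auto simp: G_def)
    then have "s = u * N - i" using N by simp
    with i(1) \<open>u \<in> bad\<close> s(3) show False by force
  qed
  define B where "B = (\<Union>k. \<Union>u\<in>G. {x. x $ k = u \<and> peval P x = 0})"
  have line: "finite {x. x $ k = u \<and> peval P x = 0}" "card {x. x $ k = u \<and> peval P x = 0} \<le> d"
    if "u \<in> G" for k u
    using zeros_on_axis_parallel_line[OF P(1) good[OF that, of k], of k] by (simp_all add: qk)
  have "finite B" unfolding B_def using G line by auto
  have "card B \<le> (\<Sum>k\<in>(UNIV::2 set). card (\<Union>u\<in>G. {x. x $ k = u \<and> peval P x = 0}))"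
    unfolding B_def by (rule card_UN_le) simp
  also have "\<dots> \<le> (\<Sum>k\<in>(UNIV::2 set). (N + 2) * d)"
  proof (rule sum_mono)
    fix k :: 2
    have "card (\<Union>u\<in>G. {x. x $ k = u \<and> peval P x = 0}) \<le> (\<Sum>u\<in>G. card {x. x $ k = u \<and> peval P x = 0})"
      by (rule card_UN_le[OF G(1)])
    also have "\<dots> \<le> (\<Sum>u\<in>G. d)" by (rule sum_mono) (rule line)
    also have "\<dots> \<le> (N + 2) * d" using mult_right_mono[OF G(2), of d] by simp
    finally show "card (\<Union>u\<in>G. {x. x $ k = u \<and> peval P x = 0}) \<le> (N + 2) * d" .
  qed
  finally have cardB: "card B \<le> 2 * (N + 2) * d" by simp
  have cell: "\<exists>a. z \<in> cube a (1 / N) \<and> (\<forall>k. a $ k \<in> G \<and> a $ k + 1 / N \<in> G)" if z: "z \<in> Z" for z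
  proof -
    have "\<exists>u. u \<le> z $ k \<and> z $ k \<le> u + 1 / N \<and> u \<in> G \<and> u + 1 / N \<in> G" for k
    proof -
      define i where "i = \<lfloor>z $ k * N - s\<rfloor>"
      have zk: "0 \<le> z $ k" "z $ k \<le> 1" using z Z(2) by (auto simp: unit_cube_def)
      have i: "i \<le> z $ k * N - s" "z $ k * N - s < i + 1" by (auto simp: i_def)
      have "0 \<le> z $ k * N" "z $ k * N \<le> N" using zk by (auto simp: mult_left_le_one_le)
      then have "-1 < of_int i + (1::real)" "of_int i < real N"
        using i s by linarith+
      then have "-1 \<le> i" "i + 1 \<le> int N" by linarith+
      moreover have "(j + s) / N \<in> G" if "-1 \<le> j" "j \<le> int N" for j :: int
        unfolding G_def using that by (intro image_eqI[of _ _ j]) auto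
      ultimately have "(i + s) / N \<in> G" "(of_int (i + 1) + s) / N \<in> G"
        by (smt (verit))+
      moreover have "(of_int (i + 1) + s) / N = (i + s) / N + 1 / N" by (simp add: add_divide_distrib)
      moreover have "(i + s) / N \<le> z $ k" "z $ k \<le> (of_int (i + 1) + s) / N"
        using i N by (simp_all add: field_simps)
      ultimately show ?thesis by metis
    qed
    then obtain a where a: "\<And>k. a k \<le> z $ k \<and> z $ k \<le> a k + 1 / N \<and> a k \<in> G \<and> a k + 1 / N \<in> G"
      by metis
    then show ?thesis by (intro exI[of _ "\<chi> k. a k"]) (auto simp: cube_def)
  qed
  show thesis
  proof (cases "\<exists>a. Z \<subseteq> cube a (1 / N)")
    case True
    then obtain a where "Z \<subseteq> cube a (1 / N)" by blast
    also have "cube a (1 / N) \<subseteq> cube a (2 / N)"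
      by (auto simp: cube_def) (smt (verit) divide_right_mono of_nat_0_le_iff)
    finally show thesis by (intro that[of "{a}"]) auto
  next
    case False
    have "Z \<subseteq> (\<Union>a\<in>(\<lambda>b. b - (\<chi> i. 1 / N)) ` B. cube a (2 / N))"
    proof
      fix z assume z: "z \<in> Z"
      then obtain a where a: "z \<in> cube a (1 / N)" "\<And>k. a $ k \<in> G \<and> a $ k + 1 / N \<in> G"
        using cell by blast
      have box: "cube a (1 / N) = cbox a (a + (\<chi> i. 1 / N))"
        by (auto simp: cube_def mem_box_cart)
      \<comment> \<open>Connectedness enters here: \<open>Z\<close> meets the cell and its complement, hence its boundary.\<close>
      have "Z \<inter> frontier (cube a (1 / N)) \<noteq> {}"
        using Z(1) z a(1) False by (intro connected_Int_frontier) auto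
      then obtain b where b: "b \<in> Z" "b \<in> cube a (1 / N)" "b \<notin> box a (a + (\<chi> i. 1 / N))"
        by (auto simp: box frontier_cbox)
      then obtain k where "b $ k = a $ k \<or> b $ k = a $ k + 1 / N"
        by (auto simp: cube_def mem_box_cart not_less) (metis order_antisym)+
      then have "b $ k \<in> G" using a(2)[of k] by auto
      then have "b \<in> B" using b(1) Z(3) by (auto simp: B_def)
      moreover have "z \<in> cube (b - (\<chi> i. 1 / N)) (2 / N)"
      proof -
        have "b $ i - 1 / N \<le> z $ i" "z $ i \<le> b $ i - 1 / N + 2 / N" for i
        proof -
          have "a $ i \<le> z $ i" "z $ i \<le> a $ i + 1 / N" "a $ i \<le> b $ i" "b $ i \<le> a $ i + 1 / N"
            using a(1) b(2) by (auto simp: cube_def)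
          then show "b $ i - 1 / N \<le> z $ i" "z $ i \<le> b $ i - 1 / N + 2 / N"
            by (auto simp: field_simps)
        qed
        then show ?thesis by (simp add: cube_def)
      qed
      ultimately show "z \<in> (\<Union>a\<in>(\<lambda>b. b - (\<chi> i. 1 / N)) ` B. cube a (2 / N))" by blast
    qed
    moreover have "card ((\<lambda>b. b - (\<chi> i. 1 / N)) ` B) \<le> 2 * (N + 2) * d + 1"
      using card_image_le[OF \<open>finite B\<close>, of "\<lambda>b. b - (\<chi> i. 1 / N)"] cardB by linarith
    ultimately show thesis by (intro that[OF finite_imageI[OF \<open>finite B\<close>]])
  qed
qed

lemma hausdorff_measure_connected_zeros_le:
  fixes P :: "2 rpoly"
  assumes P: "total_degree_le P d" "peval P x0 \<noteq> 0"
    and Z: "connected Z" "Z \<subseteq> unit_cube" "\<forall>z\<in>Z. peval P z = 0"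
  shows "hausdorff_measure 1 Z \<le> ennreal (4 * sqrt 2 * real d)"
proof -
  define g where "g N = (real (2 * (N + 2) * d + 1)) * (sqrt 2 * (2 / real N))" for N :: nat
  have lim: "g \<longlonglongrightarrow> 4 * sqrt 2 * real d"
  proof -
    have "(\<lambda>N. 4 * sqrt 2 * real d + (8 * sqrt 2 * real d + 2 * sqrt 2) * (1 / real N))
        \<longlonglongrightarrow> 4 * sqrt 2 * real d + (8 * sqrt 2 * real d + 2 * sqrt 2) * 0"
      by (intro tendsto_intros lim_1_over_n)
    moreover have "\<forall>\<^sub>F N in sequentially.
        4 * sqrt 2 * real d + (8 * sqrt 2 * real d + 2 * sqrt 2) * (1 / real N) = g N"
      using eventually_gt_at_top[of 0] by eventually_elim (simp add: g_def field_simps)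
    ultimately show ?thesis by (simp add: tendsto_cong)
  qed
  have "filterlim (\<lambda>N. sqrt 2 * (2 / real N)) (at_right 0) sequentially"
    unfolding filterlim_at
  proof
    have "(\<lambda>N. sqrt 2 * 2 * (1 / real N)) \<longlonglongrightarrow> sqrt 2 * 2 * 0"
      by (intro tendsto_intros lim_1_over_n)
    then show "(\<lambda>N. sqrt 2 * (2 / real N)) \<longlonglongrightarrow> 0" by simp
    show "\<forall>\<^sub>F N in sequentially. sqrt 2 * (2 / real N) \<in> {0<..} \<and> sqrt 2 * (2 / real N) \<noteq> 0"
      using eventually_gt_at_top[of 0] by eventually_elim auto
  qed
  then show ?thesis
  proof (rule hausdorff_measure_le_limit[OF sequentially_bot _ lim])
    show "\<forall>\<^sub>F N in sequentially. hausdorff_content 1 (sqrt 2 * (2 / real N)) Z \<le> ennreal (g N)"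
      using eventually_ge_at_top[of 1]
    proof eventually_elim
      case (elim N)
      obtain S where S: "finite S" "card S \<le> 2 * (N + 2) * d + 1" "Z \<subseteq> (\<Union>a\<in>S. cube a (2 / N))"
        using cover_connected_zeros[OF P elim Z] by blast
      have "hausdorff_content 1 (sqrt 2 * (2 / real N)) Z
          \<le> ennreal (real (card S) * hpow (sqrt 2 * (2 / real N)) 1)"
        using hausdorff_content_le_cubes[OF S(1,3), of 1] by simp
      also have "\<dots> \<le> ennreal (g N)"
      proof (rule ennreal_leI)
        have "real (card S) \<le> real (2 * (N + 2) * d + 1)"
          using S(2) by (rule of_nat_mono)
        then show "real (card S) * hpow (sqrt 2 * (2 / real N)) 1 \<le> g N"
          unfolding g_def hpow_def by (simp add: mult_right_mono del: of_nat_add of_nat_mult times_divide_eq_right)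
      qed
      finally show ?case .
    qed
  qed
qed

theorem theorem2p3:
  fixes d :: nat
  assumes "d \<ge> 1"
  shows "(\<forall>(C :: nat \<Rightarrow> nat \<Rightarrow> nat \<Rightarrow> real) (Z :: (real^'n::finite) set).
            vitushkin_constants TYPE('n) d (\<lambda>i. C i CARD('n) d) \<longrightarrow>
            Z \<subseteq> unit_cube \<longrightarrow>
            hausdorff_measure (real (CARD('n) - 1)) Z
              > ennreal (2 * sqrt (real CARD('n) ^ (CARD('n) - 1)) * C (CARD('n) - 1) CARD('n) d) \<longrightarrow>
            d_definite d Z)
       \<and> (\<forall>Z :: (real^2) set.
            is_curve Z \<longrightarrow> Z \<subseteq> unit_cube \<longrightarrow>
            curve_length Z > ennreal (16 * sqrt 2 * real d) \<longrightarrow>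
            d_definite d Z)"
proof (intro conjI allI impI)
  fix C :: "nat \<Rightarrow> nat \<Rightarrow> nat \<Rightarrow> real" and Z :: "(real^'n) set"
  assume C: "vitushkin_constants TYPE('n) d (\<lambda>i. C i CARD('n) d)" and Z: "Z \<subseteq> unit_cube"
    and large: "hausdorff_measure (real (CARD('n) - 1)) Z
      > ennreal (2 * sqrt (real CARD('n) ^ (CARD('n) - 1)) * C (CARD('n) - 1) CARD('n) d)"
  show "d_definite d Z"
  proof (rule ccontr)
    assume "\<not> d_definite d Z"
    then obtain P x0 where P: "total_degree_le P d" "\<forall>z\<in>Z. peval P z = 0" "peval P x0 \<noteq> 0"
      using vanishing_polynomial_if_not_d_definite[OF Z] by blast
    have "0 < C (CARD('n) - 1) CARD('n) d"
      using C by (simp add: vitushkin_constants_def)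
    then have "sqrt (real CARD('n) ^ (CARD('n) - 1)) * C (CARD('n) - 1) CARD('n) d
        \<le> 2 * sqrt (real CARD('n) ^ (CARD('n) - 1)) * C (CARD('n) - 1) CARD('n) d"
      by simp
    with hausdorff_measure_zeros_le[OF C P(1,3) Z P(2)] large show False
      by (meson ennreal_leI leD order_trans)
  qed
next
  fix Z :: "(real^2) set"
  assume curve: "is_curve Z" and Z: "Z \<subseteq> unit_cube"
    and long: "curve_length Z > ennreal (16 * sqrt 2 * real d)"
  have "connected Z"
    using curve unfolding is_curve_def
    by (metis connected_continuous_image is_interval_connected)
  show "d_definite d Z"
  proof (rule ccontr)
    assume "\<not> d_definite d Z"
    then obtain P x0 where P: "total_degree_le P d" "\<forall>z\<in>Z. peval P z = 0" "peval P x0 \<noteq> 0"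
      using vanishing_polynomial_if_not_d_definite[OF Z] by blast
    have "4 * sqrt 2 * real d \<le> 16 * sqrt 2 * real d" by simp
    with hausdorff_measure_connected_zeros_le[OF P(1,3) \<open>connected Z\<close> Z P(2)] long show False
      unfolding curve_length_def by (meson ennreal_leI leD order_trans)
  qed
qed

end
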